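(* Let $f=(f_1,\ldots,f_m)\colon\mathbb{R}^n\to\mathbb{R}^m$ be a polynomial map. Assume that there exists $\bar t\in f(\mathbb{R}^n)$ such that the section $[f(\mathbb{R}^n)]_{\bar t}$ is bounded. Then the problem $\mathrm{Min}_{\,\mathbb{R}^m_+}\{f(x)\mid x\in\mathbb{R}^n\}$ admits a Pareto solution if one of the following equivalent conditions holds: (i) $f$ is proper at the sublevel $\bar t$; (ii) $f$ satisfies the Palais--Smale condition at the sublevel $\bar t$: $\widetilde K_{\infty,\le\bar t}(f)=\emptyset$; (iii) $f$ satisfies the weak Palais--Smale condition at the sublevel $\bar t$: $K_{\infty,\le\bar t}(f)=\emptyset$; (iv) $f$ is $M$-tame at the sublevel $\bar t$: $T_{\infty,\le\bar t}(f)=\emptyset$.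
   Context: $n,m\ge1$; $\mathbb{R}^m_+$ is the nonnegative orthant; for $s,t\in\mathbb{R}^m$, $s\le t$ means $t-s\in\mathbb{R}^m_+$. A point $x^*\in\mathbb{R}^n$ is a Pareto solution of the problem $\mathrm{Min}_{\,\mathbb{R}^m_+}\{f(x)\mid x\in\mathbb{R}^n\}$ if $f(x)\notin f(x^* )-(\mathbb{R}^m_+\setminus\{0\})$ for all $x\in\mathbb{R}^n$. For $A\subset\mathbb{R}^m$ and $\bar t\in\mathbb{R}^m$, the section of $A$ at $\bar t$ is $[A]_{\bar t}:=A\cap(\bar t-\mathbb{R}^m_+)$. It is called bounded if there is $a\in\mathbb{R}^m$ with $[A]_{\bar t}\subset a+\mathbb{R}^m_+$. $f$ is proper at the sublevel $\bar t\in\mathbb{R}^m$ if for each compact subset $A\subset[\mathbb{R}^m]_{\bar t}=\bar t-\mathbb{R}^m_+$ the inverse image $f^{-1}(A)$ is compact. The Rabier function is $\nu_f(x):=\min_{\sum_{i=1}^m|\lambda_i|=1}\big\|\sum_{i=1}^m\lambda_i\nabla f_i(x)\big\|$. The tangency variety is $$\Gamma(f)=\Big\{x\in\mathbb{R}^n\ \Big|\ \exists\,\lambda_1,\ldots,\lambda_m,\mu\in\mathbb{R}\text{ not all zero with }\sum_{i=1}^m\lambda_i\nabla f_i(x)+\mu x=0\Big\}.$$ Define: $\widetilde K_{\infty,\le\bar t}(f)$ = set of $t\in\mathbb{R}^m$ for which there is a sequence $\{x^k\}\subset\mathbb{R}^n$ with $f(x^k)\le\bar t$ for all $k$, $\|x^k\|\to+\infty$,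 $f(x^k)\to t$ and $\nu_f(x^k)\to0$ as $k\to\infty$; $K_{\infty,\le\bar t}(f)$ = set of $t\in\mathbb{R}^m$ for which there is a sequence $\{x^k\}\subset\mathbb{R}^n$ with $f(x^k)\le\bar t$ for all $k$, $\|x^k\|\to+\infty$, $f(x^k)\to t$ and $\|x^k\|\nu_f(x^k)\to0$ as $k\to\infty$; $T_{\infty,\le\bar t}(f)$ = set of $t\in\mathbb{R}^m$ for which there is a sequence $\{x^k\}\subset\Gamma(f)$ with $f(x^k)\le\bar t$ for all $k$, $\|x^k\|\to+\infty$ and $f(x^k)\to t$ as $k\to\infty$. *)

theory Defs
  imports "HOL-Analysis.Analysis"
begin

definition nonneg_orthant :: "(real ^ 'm) set" where
  "nonneg_orthant = {s. 0 \<le> s}"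

text \<open>The order of the library on \<^typ>\<open>real ^ 'm\<close> is componentwise, so it is the order
  induced by the nonnegative orthant.\<close>

lemma le_iff_diff_nonneg_orthant: "s \<le> t \<longleftrightarrow> t - s \<in> nonneg_orthant"
  for s t :: "real ^ 'm"
  by (simp add: nonneg_orthant_def less_eq_vec_def)

definition pareto_solution :: "(real ^ 'n \<Rightarrow> real ^ 'm) \<Rightarrow> real ^ 'n \<Rightarrow> bool" where
  "pareto_solution f xs \<longleftrightarrow> (\<forall>x. f x \<notin> (\<lambda>s. f xs - s) ` (nonneg_orthant - {0}))"

definition section_at :: "(real ^ 'm) set \<Rightarrow> real ^ 'm \<Rightarrow> (real ^ 'm) set" where
  "section_at A t = A \<inter> (\<lambda>s. t - s) ` nonneg_orthant"

text \<open>A bounded section is one bounded from below; this depends only on the section as a set.\<close>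

definition orthant_bounded :: "(real ^ 'm) set \<Rightarrow> bool" where
  "orthant_bounded S \<longleftrightarrow> (\<exists>a. S \<subseteq> (\<lambda>s. a + s) ` nonneg_orthant)"

definition proper_at_sublevel :: "(real ^ 'n \<Rightarrow> real ^ 'm) \<Rightarrow> real ^ 'm \<Rightarrow> bool" where
  "proper_at_sublevel f t \<longleftrightarrow>
     (\<forall>A. compact A \<and> A \<subseteq> section_at UNIV t \<longrightarrow> compact (f -` A))"

definition gradient :: "('a::real_inner \<Rightarrow> real) \<Rightarrow> 'a \<Rightarrow> 'a" where
  "gradient g x = (THE D. GDERIV g x :> D)"

lemma GDERIV_unique:
  assumes "GDERIV g x :> D" "GDERIV g x :> E"
  shows "D = E"
proof -
  have "(\<lambda>h. inner h D) = (\<lambda>h. inner h E)"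
    using assms unfolding gderiv_def by (rule has_derivative_unique)
  then have "inner (D - E) D = inner (D - E) E" by (rule fun_cong)
  then have "inner (D - E) (D - E) = 0" by (simp add: inner_diff_right)
  then show ?thesis by simp
qed

lemma gradient_eq: "GDERIV g x :> D \<Longrightarrow> gradient g x = D"
  unfolding gradient_def using GDERIV_unique by blast

lemma GDERIV_gradient:
  fixes g :: "'a::euclidean_space \<Rightarrow> real"
  assumes "g differentiable (at x)"
  shows "GDERIV g x :> gradient g x"
proof -
  obtain g' where g': "(g has_derivative g') (at x)"
    using assms unfolding differentiable_def by blast
  interpret bounded_linear g' using g' by (rule has_derivative_bounded_linear)
  define D where "D = (\<Sum>b\<in>Basis. g' b *\<^sub>R b)"
  have "g' h = inner h D" for h
  proof -
    have "g' h = g' (\<Sum>b\<in>Basis. inner h b *\<^sub>R b)" by (simp add: euclidean_representation)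
    also have "\<dots> = inner h D"
      by (simp add: D_def sum scaleR inner_sum_right mult.commute)
    finally show ?thesis .
  qed
  then have "g' = (\<lambda>h. inner h D)" by blast
  then have "GDERIV g x :> D" using g' by (simp add: gderiv_def)
  then show ?thesis by (simp add: gradient_eq)
qed

text \<open>The minimum in the Rabier function is written as an infimum; by the lemma
  \<open>rabier_attained\<close> below it is a minimum.\<close>

definition rabier :: "(real ^ 'n \<Rightarrow> real ^ 'm) \<Rightarrow> real ^ 'n \<Rightarrow> real" where
  "rabier f x = (INF l \<in> {l :: real ^ 'm. (\<Sum>i\<in>UNIV. \<bar>l $ i\<bar>) = 1}.
      norm (\<Sum>i\<in>UNIV. l $ i *\<^sub>R gradient (\<lambda>y. f y $ i) x))"

lemma rabier_attained:
  fixes f :: "real ^ 'n \<Rightarrow> real ^ 'm"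
  obtains l where "(\<Sum>i\<in>UNIV. \<bar>l $ i\<bar>) = 1"
    and "rabier f x = norm (\<Sum>i\<in>UNIV. l $ i *\<^sub>R gradient (\<lambda>y. f y $ i) x)"
proof -
  define S where "S = {l :: real ^ 'm. (\<Sum>i\<in>UNIV. \<bar>l $ i\<bar>) = 1}"
  define h where "h = (\<lambda>l :: real ^ 'm. norm (\<Sum>i\<in>UNIV. l $ i *\<^sub>R gradient (\<lambda>y. f y $ i) x))"
  have "closed S" unfolding S_def
  proof (rule closed_Collect_eq)
    show "continuous_on UNIV (\<lambda>l :: real ^ 'm. \<Sum>i\<in>UNIV. \<bar>l $ i\<bar>)"
      by (intro continuous_intros)
  qed (rule continuous_on_const)
  moreover have "bounded S"
    unfolding bounded_iff
  proof (intro exI ballI)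
    fix l assume "l \<in> S"
    then show "norm l \<le> 1" using norm_le_l1_cart[of l] by (simp add: S_def)
  qed
  ultimately have "compact S" by (simp add: compact_eq_bounded_closed)
  moreover have "S \<noteq> {}"
  proof -
    have "(\<Sum>i\<in>UNIV. \<bar>axis (undefined :: 'm) (1 :: real) $ i\<bar>) =
        (\<Sum>i\<in>UNIV. if i = (undefined :: 'm) then 1 else 0)"
      by (rule sum.cong) (auto simp: axis_def)
    also have "\<dots> = 1" by simp
    finally have "axis undefined 1 \<in> S" unfolding S_def by (rule CollectI)
    then show ?thesis by blast
  qed
  moreover have "continuous_on S h" unfolding h_def by (intro continuous_intros)
  ultimately obtain l where l: "l \<in> S" "\<And>k. k \<in> S \<Longrightarrow> h l \<le> h k"
    using continuous_attains_inf[of S h] by metis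
  have "(INF k\<in>S. h k) = h l"
  proof (rule cInf_eq_minimum)
    show "h l \<in> h ` S" using l(1) by (rule imageI)
    show "h l \<le> y" if "y \<in> h ` S" for y using that l(2) by blast
  qed
  then have "rabier f x = h l" unfolding rabier_def S_def h_def .
  moreover have "(\<Sum>i\<in>UNIV. \<bar>l $ i\<bar>) = 1" using l(1) unfolding S_def by (rule CollectD)
  ultimately show ?thesis unfolding h_def by (rule that[rotated])
qed

definition tangency_variety :: "(real ^ 'n \<Rightarrow> real ^ 'm) \<Rightarrow> (real ^ 'n) set" where
  "tangency_variety f =
     {x. \<exists>(l :: real ^ 'm) (\<mu> :: real). \<not> ((\<forall>i. l $ i = 0) \<and> \<mu> = 0) \<and>
        (\<Sum>i\<in>UNIV. l $ i *\<^sub>R gradient (\<lambda>y. f y $ i) x) + \<mu> *\<^sub>R x = 0}"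

definition Ktilde_inf :: "(real ^ 'n \<Rightarrow> real ^ 'm) \<Rightarrow> real ^ 'm \<Rightarrow> (real ^ 'm) set" where
  "Ktilde_inf f tb = {t. \<exists>x :: nat \<Rightarrow> real ^ 'n.
     (\<forall>k. f (x k) \<le> tb) \<and>
     filterlim (\<lambda>k. norm (x k)) at_top sequentially \<and>
     (\<lambda>k. f (x k)) \<longlonglongrightarrow> t \<and>
     (\<lambda>k. rabier f (x k)) \<longlonglongrightarrow> 0}"

definition K_inf :: "(real ^ 'n \<Rightarrow> real ^ 'm) \<Rightarrow> real ^ 'm \<Rightarrow> (real ^ 'm) set" where
  "K_inf f tb = {t. \<exists>x :: nat \<Rightarrow> real ^ 'n.
     (\<forall>k. f (x k) \<le> tb) \<and>
     filterlim (\<lambda>k. norm (x k)) at_top sequentially \<and>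
     (\<lambda>k. f (x k)) \<longlonglongrightarrow> t \<and>
     (\<lambda>k. norm (x k) * rabier f (x k)) \<longlonglongrightarrow> 0}"

definition T_inf :: "(real ^ 'n \<Rightarrow> real ^ 'm) \<Rightarrow> real ^ 'm \<Rightarrow> (real ^ 'm) set" where
  "T_inf f tb = {t. \<exists>x :: nat \<Rightarrow> real ^ 'n.
     (\<forall>k. x k \<in> tangency_variety f) \<and>
     (\<forall>k. f (x k) \<le> tb) \<and>
     filterlim (\<lambda>k. norm (x k)) at_top sequentially \<and>
     (\<lambda>k. f (x k)) \<longlonglongrightarrow> t}"

definition palais_smale_at :: "(real ^ 'n \<Rightarrow> real ^ 'm) \<Rightarrow> real ^ 'm \<Rightarrow> bool" where
  "palais_smale_at f tb \<longleftrightarrow> Ktilde_inf f tb = {}"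

definition weak_palais_smale_at :: "(real ^ 'n \<Rightarrow> real ^ 'm) \<Rightarrow> real ^ 'm \<Rightarrow> bool" where
  "weak_palais_smale_at f tb \<longleftrightarrow> K_inf f tb = {}"

definition M_tame_at :: "(real ^ 'n \<Rightarrow> real ^ 'm) \<Rightarrow> real ^ 'm \<Rightarrow> bool" where
  "M_tame_at f tb \<longleftrightarrow> T_inf f tb = {}"

end

theory Submission
  imports Defs
begin

text \<open>Everything reduces to the sublevel set \<open>{x. f x \<le> tb}\<close>, on which \<open>f\<close> takes values in a compact
  box: properness means that this set is bounded, and if it is unbounded then each of the three
  sets of asymptotic values is nonempty. For \<open>T_inf\<close>, minimise one component of \<open>f\<close> over the
  sublevel set intersected with a large sphere: outside the tangency variety some tangent direction
  of the sphere decreases all components of \<open>f\<close> at once. For \<open>K_inf\<close>, minimise one component plus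
  a small multiple of \<open>\<bar>ln (norm x / R)\<bar>\<close>, in the manner of Ekeland's principle: as the component is
  bounded, the minimum stays within a bounded logarithmic distance of the sphere of radius
  \<open>R\<close>, and at a minimum \<open>norm x * rabier f x\<close> is small.\<close>

section \<open>Common descent directions for finitely many gradients\<close>

text \<open>The point of the convex hull of the \<open>g j\<close> closest to the origin satisfies
  the variational inequality of a projection. When that point \<open>w\<close> is nonzero,
  \<open>- w\<close> has negative inner product with every \<open>g j\<close>.\<close>

lemma min_norm_convex_combination:
  fixes g :: "'m::finite \<Rightarrow> 'a::euclidean_space"
  obtains u :: "real ^ 'm" where "\<And>i. 0 \<le> u $ i" "(\<Sum>i\<in>UNIV. u $ i) = 1"
    "\<And>j. (norm (\<Sum>i\<in>UNIV. u $ i *\<^sub>R g i))\<^sup>2 \<le> (\<Sum>i\<in>UNIV. u $ i *\<^sub>R g i) \<bullet> g j"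
proof -
  define U where "U = {u :: real ^ 'm. (\<forall>i. 0 \<le> u $ i) \<and> (\<Sum>i\<in>UNIV. u $ i) = 1}"
  define C where "C = convex hull (range g)"
  \<comment> \<open>The image of the standard simplex is convex and contains every
    \<open>g j\<close>; this yields coefficients \<open>u\<close> for the closest point.\<close>
  have hull: "C \<subseteq> (\<lambda>u. \<Sum>i\<in>UNIV. u $ i *\<^sub>R g i) ` U"
    unfolding C_def
  proof (rule hull_minimal)
    show "range g \<subseteq> (\<lambda>u. \<Sum>i\<in>UNIV. u $ i *\<^sub>R g i) ` U"
    proof
      fix y assume "y \<in> range g"
      then obtain j where j: "y = g j" by blast
      have "(\<Sum>i\<in>UNIV. axis j (1::real) $ i *\<^sub>R g i) = g j"
        by (simp add: axis_def if_distrib[of "\<lambda>c. c *\<^sub>R _"] cong: if_cong)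
      moreover have "axis j 1 \<in> U" by (simp add: U_def axis_def)
      ultimately show "y \<in> (\<lambda>u. \<Sum>i\<in>UNIV. u $ i *\<^sub>R g i) ` U" using j by force
    qed
    have "convex U"
      unfolding U_def convex_def
      by (auto simp: sum.distrib simp flip: sum_distrib_left)
    moreover have "linear (\<lambda>u :: real ^ 'm. \<Sum>i\<in>UNIV. u $ i *\<^sub>R g i)"
      by (rule linearI) (simp_all add: scaleR_add_left sum.distrib scaleR_sum_right)
    ultimately show "convex ((\<lambda>u. \<Sum>i\<in>UNIV. u $ i *\<^sub>R g i) ` U)"
      by (rule convex_linear_image[rotated])
  qed
  have C: "convex C" "compact C" "C \<noteq> {}"
    by (auto simp: C_def finite_imp_compact_convex_hull)
  define w where "w = closest_point C 0"
  have "w \<in> C"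
    unfolding w_def using C by (intro closest_point_in_set) (auto simp: compact_imp_closed)
  then obtain u where u: "u \<in> U" "w = (\<Sum>i\<in>UNIV. u $ i *\<^sub>R g i)" using hull by blast
  have "(norm w)\<^sup>2 \<le> w \<bullet> g j" for j
  proof -
    have "g j \<in> C" by (simp add: C_def hull_inc)
    then have "(0 - w) \<bullet> (g j - w) \<le> 0"
      unfolding w_def using C by (intro closest_point_dot) (auto simp: compact_imp_closed)
    then show ?thesis by (simp add: inner_diff_right power2_norm_eq_inner)
  qed
  then show ?thesis using u by (intro that[of u]) (auto simp: U_def)
qed

lemma GDERIV_component:
  fixes f :: "real ^ 'n \<Rightarrow> real ^ 'm"
  assumes "f differentiable (at x)"
  shows "GDERIV (\<lambda>y. f y $ i) x :> gradient (\<lambda>y. f y $ i) x"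
proof (rule GDERIV_gradient)
  show "(\<lambda>y. f y $ i) differentiable (at x)"
    using assms bounded_linear.has_derivative[OF bounded_linear_vec_nth]
    unfolding differentiable_def by blast
qed

text \<open>Each \<open>f (\<gamma> s) $ i - s * d\<close> has negative derivative at 0, and
  finitely many components share one interval of decrease. The curve will be a great circle with
  \<open>d = 0\<close>, or a line with a negative slope \<open>d\<close>.\<close>

lemma eventually_decrease_along_curve:
  fixes f :: "real ^ 'n \<Rightarrow> real ^ 'm" and \<gamma> :: "real \<Rightarrow> real ^ 'n"
  assumes "f differentiable (at (\<gamma> 0))" and "(\<gamma> has_vector_derivative v) (at 0)"
    and "\<And>i. v \<bullet> gradient (\<lambda>y. f y $ i) (\<gamma> 0) < d"
  shows "\<forall>\<^sub>F s in at_right 0. \<forall>i. f (\<gamma> s) $ i < f (\<gamma> 0) $ i + s * d"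
proof (rule eventually_all_finite)
  fix i
  define D where "D = gradient (\<lambda>y. f y $ i) (\<gamma> 0)"
  have "((\<lambda>y. f y $ i) has_derivative (\<lambda>h. h \<bullet> D)) (at (\<gamma> 0))"
    using GDERIV_component[OF assms(1)] by (simp add: gderiv_def D_def)
  from has_derivative_compose[OF assms(2)[unfolded has_vector_derivative_def] this]
  have "((\<lambda>s. f (\<gamma> s) $ i) has_real_derivative v \<bullet> D) (at 0)"
    unfolding has_field_derivative_def
    by (rule has_derivative_eq_rhs) (simp add: fun_eq_iff mult.commute)
  then have "((\<lambda>s. f (\<gamma> s) $ i - s * d) has_real_derivative v \<bullet> D - d) (at 0)"
    by (auto intro!: derivative_eq_intros)
  moreover have "v \<bullet> D - d < 0" using assms(3)[of i] by (simp add: D_def)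
  ultimately obtain e where e: "e > 0"
    "\<And>h. 0 < h \<Longrightarrow> h < e \<Longrightarrow> f (\<gamma> h) $ i - h * d < f (\<gamma> 0) $ i"
    using has_real_derivative_neg_dec_right[of "\<lambda>s. f (\<gamma> s) $ i - s * d" "v \<bullet> D - d" 0 UNIV]
    by auto
  then show "\<forall>\<^sub>F s in at_right 0. f (\<gamma> s) $ i < f (\<gamma> 0) $ i + s * d"
    unfolding eventually_at_right_field by (intro exI[of _ e]) force
qed

text \<open>Convex weights compete in the infimum defining \<open>rabier\<close>, so the shortest
  convex combination \<open>w\<close> of the gradients has norm at least \<open>rabier f x\<close>;
  normalising \<open>- w\<close> gives \<open>v\<close>.\<close>

lemma common_descent_direction_rabier:
  fixes f :: "real ^ 'n \<Rightarrow> real ^ 'm"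
  assumes "0 < rabier f x"
  obtains v where "norm v = 1" "\<And>i. v \<bullet> gradient (\<lambda>y. f y $ i) x \<le> - rabier f x"
proof -
  define g where "g = (\<lambda>i. gradient (\<lambda>y. f y $ i) x)"
  obtain u :: "real ^ 'm" where u: "\<And>i. 0 \<le> u $ i" "(\<Sum>i\<in>UNIV. u $ i) = 1"
    "\<And>j. (norm (\<Sum>i\<in>UNIV. u $ i *\<^sub>R g i))\<^sup>2 \<le> (\<Sum>i\<in>UNIV. u $ i *\<^sub>R g i) \<bullet> g j"
    by (rule min_norm_convex_combination[of g]) blast
  define w where "w = (\<Sum>i\<in>UNIV. u $ i *\<^sub>R g i)"
  have le: "rabier f x \<le> norm w"
    unfolding rabier_def w_def g_def using u(1,2)
    by (intro cINF_lower bdd_belowI2[of _ 0]) auto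
  then have w: "norm w > 0" using assms by linarith
  show ?thesis
  proof
    show "norm (- (w /\<^sub>R norm w)) = 1" using w by simp
    fix i
    have "norm w \<le> (w \<bullet> g i) / norm w"
      using u(3)[of i] w by (simp add: w_def[symmetric] field_simps power2_eq_square)
    then show "- (w /\<^sub>R norm w) \<bullet> gradient (\<lambda>y. f y $ i) x \<le> - rabier f x"
      using le by (simp add: g_def divide_inverse mult.commute)
  qed
qed

text \<open>Here the shortest convex combination is taken of the gradients projected to the
  hyperplane orthogonal to \<open>x\<close>. Scaling \<open>v\<close> to the length of
  \<open>x\<close> makes \<open>cos s *\<^sub>R x + sin s *\<^sub>R v\<close> a curve on the
  sphere.\<close>

lemma common_tangent_descent_direction:
  fixes f :: "real ^ 'n \<Rightarrow> real ^ 'm"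
  assumes "x \<notin> tangency_variety f" "x \<noteq> 0"
  obtains v where "v \<bullet> x = 0" "norm v = norm x" "\<And>i. v \<bullet> gradient (\<lambda>y. f y $ i) x < 0"
proof -
  define g where "g = (\<lambda>i. gradient (\<lambda>y. f y $ i) x)"
  define p where "p = (\<lambda>i. g i - ((g i \<bullet> x) / (x \<bullet> x)) *\<^sub>R x)"
  have p_x: "p i \<bullet> x = 0" for i using assms(2) by (simp add: p_def inner_diff_left)
  obtain u :: "real ^ 'm" where u: "\<And>i. 0 \<le> u $ i" "(\<Sum>i\<in>UNIV. u $ i) = 1"
    "\<And>j. (norm (\<Sum>i\<in>UNIV. u $ i *\<^sub>R p i))\<^sup>2 \<le> (\<Sum>i\<in>UNIV. u $ i *\<^sub>R p i) \<bullet> p j"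
    by (rule min_norm_convex_combination[of p]) blast
  define w where "w = (\<Sum>i\<in>UNIV. u $ i *\<^sub>R p i)"
  have w_x: "w \<bullet> x = 0" by (simp add: w_def inner_sum_left p_x)
  have "w \<noteq> 0"
  proof
    assume "w = 0"
    \<comment> \<open>Undoing the projections moves all radial parts into the multiplier of
      \<open>x\<close>; the weights sum to 1, so the relation is nontrivial.\<close>
    then have "(\<Sum>i\<in>UNIV. u $ i *\<^sub>R g i) + (- (\<Sum>i\<in>UNIV. u $ i * ((g i \<bullet> x) / (x \<bullet> x)))) *\<^sub>R x = 0"
      by (simp add: w_def p_def scaleR_diff_right sum_subtractf scaleR_sum_left)
    moreover have "\<not> (\<forall>i. u $ i = 0)" using u(2) by (metis sum.neutral zero_neq_one)
    ultimately have "x \<in> tangency_variety f"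
      unfolding tangency_variety_def g_def by blast
    then show False using assms(1) by contradiction
  qed
  show ?thesis
  proof
    define r where "r = norm x / norm w"
    have r: "r > 0" using assms(2) \<open>w \<noteq> 0\<close> by (simp add: r_def)
    show "(- r *\<^sub>R w) \<bullet> x = 0" by (simp add: w_x)
    show "norm (- r *\<^sub>R w) = norm x" using \<open>w \<noteq> 0\<close> by (simp add: r_def)
    fix i
    have "w \<bullet> p i = w \<bullet> g i" by (simp add: p_def inner_diff_right w_x)
    then have "0 < w \<bullet> g i" using u(3)[of i] \<open>w \<noteq> 0\<close>
      by (metis w_def less_le_trans zero_less_norm_iff zero_less_power)
    then show "(- r *\<^sub>R w) \<bullet> gradient (\<lambda>y. f y $ i) x < 0" using r by (simp add: g_def)
  qed
qed

section \<open>Tangency points on spheres\<close>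

lemma closed_sublevel:
  fixes f :: "'a::t2_space \<Rightarrow> real ^ 'm"
  assumes "continuous_on UNIV f"
  shows "closed {x. f x \<le> tb}"
proof -
  have "{x. f x \<le> tb} = (\<Inter>i. {x. f x $ i \<le> tb $ i})" by (auto simp: less_eq_vec_def)
  then show ?thesis
    using assms by (auto intro!: closed_INT closed_Collect_le continuous_intros)
qed

text \<open>A minimiser of one component off the tangency variety could be moved along a great
  circle with all components decreasing, hence without leaving the sublevel set.\<close>

lemma tangency_point_on_sphere:
  fixes f :: "real ^ 'n \<Rightarrow> real ^ 'm"
  assumes diff: "\<And>x. f differentiable (at x)" and "f x0 \<le> tb" and "x0 \<noteq> 0"
  obtains x where "x \<in> tangency_variety f" "f x \<le> tb" "norm x = norm x0"
proof -
  fix j0 :: 'm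
  have cont: "continuous_on UNIV f"
    by (simp add: diff differentiable_at_imp_differentiable_on differentiable_imp_continuous_on)
  define S where "S = {x. f x \<le> tb} \<inter> sphere 0 (norm x0)"
  have "compact S" unfolding S_def
    by (intro closed_Int_compact closed_sublevel cont compact_sphere)
  moreover have "S \<noteq> {}" using assms(2) by (auto simp: S_def)
  moreover have "continuous_on S (\<lambda>x. f x $ j0)"
    by (intro continuous_intros continuous_on_subset[OF cont]) simp
  ultimately obtain x where x: "x \<in> S" "\<And>y. y \<in> S \<Longrightarrow> f x $ j0 \<le> f y $ j0"
    using continuous_attains_inf[of S "\<lambda>x. f x $ j0"] by blast
  have norm_x: "norm x = norm x0" and "f x \<le> tb" using x(1) by (auto simp: S_def)
  have "x \<in> tangency_variety f"
  proof (rule ccontr)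
    assume "x \<notin> tangency_variety f"
    moreover have "x \<noteq> 0" using norm_x assms(3) by auto
    ultimately obtain v where v: "v \<bullet> x = 0" "norm v = norm x"
      "\<And>i. v \<bullet> gradient (\<lambda>y. f y $ i) x < 0"
      using common_tangent_descent_direction by blast
    define \<gamma> where "\<gamma> = (\<lambda>s. cos s *\<^sub>R x + sin s *\<^sub>R v)"
    have \<gamma>0: "\<gamma> 0 = x" by (simp add: \<gamma>_def)
    have "(\<gamma> has_vector_derivative v) (at 0)"
      unfolding \<gamma>_def by (auto intro!: derivative_eq_intros)
    then have "\<forall>\<^sub>F s in at_right 0. \<forall>i. f (\<gamma> s) $ i < f (\<gamma> 0) $ i + s * 0"
      using v(3) by (intro eventually_decrease_along_curve diff) (auto simp: \<gamma>0)
    then obtain s where s: "\<And>i. f (\<gamma> s) $ i < f x $ i"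
      using eventually_happens[of _ "at_right (0::real)"] by (auto simp: \<gamma>0)
    have "(norm (\<gamma> s))\<^sup>2 = ((cos s)\<^sup>2 + (sin s)\<^sup>2) * (norm x)\<^sup>2"
    proof -
      have "x \<bullet> v = 0" using v(1) by (simp add: inner_commute)
      moreover have "v \<bullet> v = x \<bullet> x" using v(2) by (simp add: norm_eq)
      ultimately show ?thesis
        using v(1) unfolding power2_norm_eq_inner \<gamma>_def
        by (simp add: inner_add_left inner_add_right power2_eq_square distrib_right
            del: sin_cos_squared_add3)
    qed
    then have "norm (\<gamma> s) = norm x" by (simp add: power2_eq_iff_nonneg)
    moreover have "f (\<gamma> s) \<le> tb"
      using s \<open>f x \<le> tb\<close> unfolding less_eq_vec_def by (meson less_le_trans less_imp_le)
    ultimately have "\<gamma> s \<in> S" by (simp add: S_def norm_x)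
    then show False using x(2) s by (meson not_less)
  qed
  then show ?thesis using that norm_x \<open>f x \<le> tb\<close> by blast
qed

section \<open>Almost critical points by a logarithmic penalty\<close>

text \<open>The norm changes by at most \<open>s\<close> and stays at least
  \<open>norm x / 2\<close>; this last bound, used as a denominator, causes the factor 2.\<close>

lemma abs_ln_norm_diff_le:
  fixes x v :: "'a::real_normed_vector"
  assumes "norm v = 1" "0 < s" "s \<le> norm x / 2" "x \<noteq> 0"
  shows "\<bar>ln (norm (x + s *\<^sub>R v)) - ln (norm x)\<bar> \<le> 2 * s / norm x"
proof -
  define r where "r = norm x"
  define y where "y = norm (x + s *\<^sub>R v)"
  have r: "r > 0" using assms(4) by (simp add: r_def)
  have "norm (s *\<^sub>R v) = s" using assms(1,2) by simp
  then have y: "r - s \<le> y" "y \<le> r + s"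
    unfolding r_def y_def using norm_triangle_ineq[of x "s *\<^sub>R v"] norm_diff_ineq[of x "s *\<^sub>R v"]
    by auto
  have s: "s \<le> r / 2" using assms(3) by (simp add: r_def)
  have y0: "y > 0" "y \<ge> r / 2" using y s r by auto
  have "ln y - ln r \<le> (y - r) / r"
    using ln_diff_le[of y r] y0 r by simp
  also have "\<dots> \<le> 2 * s / r"
    using y r assms(2) by (intro divide_right_mono) auto
  finally have upper: "ln y - ln r \<le> 2 * s / r" .
  have "ln r - ln y \<le> (r - y) / y"
    using ln_diff_le[of r y] y0 r by simp
  also have "\<dots> \<le> s / y"
    using y y0 by (intro divide_right_mono) auto
  also have "\<dots> \<le> s / (r / 2)"
    using y0 r assms(2) by (intro divide_left_mono) auto
  finally have lower: "ln r - ln y \<le> 2 * s / r" by (simp add: mult.commute)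
  from upper lower show ?thesis unfolding r_def y_def by linarith
qed

text \<open>If \<open>norm x * rabier f x\<close> were at least \<open>e\<close> at a minimum of
  \<open>\<phi>\<close>, a short step along a common descent direction would lower component
  \<open>j\<close> by more than the penalty can grow. The bound on \<open>e * q\<close> keeps the
  minimum off the boundary of the shell, leaving room for that step.\<close>

lemma almost_critical_point:
  fixes f :: "real ^ 'n \<Rightarrow> real ^ 'm"
  assumes diff: "\<And>x. f differentiable (at x)" and "f x0 \<le> tb" and "x0 \<noteq> 0"
    and lower: "\<And>x. f x \<le> tb \<Longrightarrow> a \<le> f x $ j"
    and e: "0 < e" "4 * (tb $ j - a) < e * q"
  obtains x where "f x \<le> tb" "norm x0 * exp (- q) \<le> norm x" "norm x * rabier f x < e"
proof -
  have cont: "continuous_on UNIV f"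
    by (simp add: diff differentiable_at_imp_differentiable_on differentiable_imp_continuous_on)
  define R where "R = norm x0"
  have R: "R > 0" using assms(3) by (simp add: R_def)
  have "a \<le> tb $ j" using lower[OF assms(2)] assms(2) by (auto simp: less_eq_vec_def intro: order_trans)
  then have q: "q > 0" using e
    by (smt (verit) mult_nonneg_nonpos)
  define S where "S = {x. f x \<le> tb} \<inter> (cball 0 (R * exp q) - ball 0 (R * exp (- q)))"
  define \<rho> where "\<rho> = (\<lambda>x :: real ^ 'n. \<bar>ln (norm x) - ln R\<bar>)"
  define \<phi> where "\<phi> = (\<lambda>x. f x $ j + e / 4 * \<rho> x)"
  \<comment> \<open>The shell is defined by balls for compactness and used in logarithmic form,
    where it reads \<open>\<rho> x \<le> q\<close>.\<close>
  have S_iff: "x \<in> S \<longleftrightarrow> f x \<le> tb \<and> x \<noteq> 0 \<and> \<rho> x \<le> q" for x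
  proof (cases "x = 0")
    case False
    have "norm x \<le> R * exp q \<longleftrightarrow> ln (norm x) - ln R \<le> q"
      using False R by (simp add: ln_ge_iff ln_mult flip: ln_le_cancel_iff) argo
    moreover have "R * exp (- q) \<le> norm x \<longleftrightarrow> ln R - ln (norm x) \<le> q"
      using False R by (simp add: ln_mult flip: ln_le_cancel_iff) argo
    ultimately show ?thesis using False by (auto simp: S_def \<rho>_def not_less)
  qed (use R in \<open>simp add: S_def\<close>)
  have "compact S" unfolding S_def
    by (intro closed_Int_compact closed_sublevel cont compact_diff compact_cball open_ball)
  moreover have x0: "x0 \<in> S" using assms(2,3) q by (simp add: S_iff \<rho>_def R_def)
  moreover have "continuous_on S \<phi>"
    unfolding \<phi>_def \<rho>_def
    by (intro continuous_intros continuous_on_subset[OF cont]) (auto simp: S_iff)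
  ultimately obtain x where x: "x \<in> S" "\<And>y. y \<in> S \<Longrightarrow> \<phi> x \<le> \<phi> y"
    using continuous_attains_inf[of S \<phi>] by blast
  have fx: "f x \<le> tb" and "x \<noteq> 0" using x(1) by (auto simp: S_iff)
  define r where "r = norm x"
  have r: "r > 0" using \<open>x \<noteq> 0\<close> by (simp add: r_def)
  \<comment> \<open>Comparison with \<open>x0\<close>, where the penalty vanishes.\<close>
  have "\<phi> x \<le> tb $ j"
    using x(2)[OF x0] assms(2) by (auto simp: \<phi>_def \<rho>_def R_def less_eq_vec_def intro: order_trans)
  then have "e * \<rho> x < e * q" using lower[OF fx] e(2) by (simp add: \<phi>_def)
  then have \<rho>: "\<rho> x < q" using e(1) by simp
  have "r * rabier f x < e"
  proof (rule ccontr)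
    assume "\<not> r * rabier f x < e"
    then have rab: "e / r \<le> rabier f x" using r by (simp add: field_simps)
    moreover have "e / r > 0" using e r by simp
    ultimately have "0 < rabier f x" by linarith
    then obtain v where v: "norm v = 1" "\<And>i. v \<bullet> gradient (\<lambda>y. f y $ i) x \<le> - rabier f x"
      using common_descent_direction_rabier by blast
    \<comment> \<open>Half of the available slope gives strictness and equals the maximal penalty
      rate \<open>e / 4 * (2 / r)\<close>.\<close>
    have "v \<bullet> gradient (\<lambda>y. f y $ i) x < - (e / (2 * r))" for i
    proof -
      have "e / (2 * r) < e / r" using e r by (simp add: field_simps)
      then show ?thesis using v(2)[of i] rab by linarith
    qed
    moreover have "((\<lambda>s. x + s *\<^sub>R v) has_vector_derivative v) (at 0)"
      by (auto intro!: derivative_eq_intros)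
    ultimately have "\<forall>\<^sub>F s in at_right 0. \<forall>i. f (x + s *\<^sub>R v) $ i < f x $ i + s * (- (e / (2 * r)))"
      using eventually_decrease_along_curve[of f "\<lambda>s. x + s *\<^sub>R v" v "- (e / (2 * r))"] diff by simp
    \<comment> \<open>The first bound serves the logarithm estimate and keeps the new point nonzero;
      the second keeps its penalty \<open>\<rho>\<close> at most \<open>q\<close>.\<close>
    moreover have "\<forall>\<^sub>F s in at_right 0. s < min (r / 2) (r * (q - \<rho> x) / 2)"
      using r \<rho> by (intro eventually_at_right_less[THEN eventually_mono] order_tendstoD(2)[OF tendsto_ident_at]) auto
    moreover have "\<forall>\<^sub>F s :: real in at_right 0. 0 < s"
      by (rule eventually_at_right_less)
    ultimately have "\<forall>\<^sub>F s in at_right 0. 0 < s \<and> s < min (r / 2) (r * (q - \<rho> x) / 2) \<and>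
        (\<forall>i. f (x + s *\<^sub>R v) $ i < f x $ i + s * (- (e / (2 * r))))"
      by eventually_elim blast
    then obtain s where s: "0 < s" "s < r / 2" "s < r * (q - \<rho> x) / 2"
      "\<And>i. f (x + s *\<^sub>R v) $ i < f x $ i + s * (- (e / (2 * r)))"
      using eventually_happens[of _ "at_right (0::real)"] by auto
    define y where "y = x + s *\<^sub>R v"
    have "\<bar>ln (norm y) - ln (norm x)\<bar> \<le> 2 * s / r"
      unfolding y_def r_def using s v(1) \<open>x \<noteq> 0\<close> by (intro abs_ln_norm_diff_le) (auto simp: r_def)
    then have \<rho>y: "\<rho> y \<le> \<rho> x + 2 * s / r" unfolding \<rho>_def by linarith
    have "2 * s / r < q - \<rho> x" using s(3) r by (simp add: field_simps)
    then have "\<rho> y \<le> q" using \<rho>y by linarith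
    moreover have "y \<noteq> 0"
    proof
      assume "y = 0"
      then have "norm x = norm (s *\<^sub>R v)" by (simp add: y_def add_eq_0_iff2)
      then show False using s v(1) r by (simp add: r_def)
    qed
    moreover have "f y $ i \<le> tb $ i" for i
    proof -
      have "0 \<le> s * (e / (2 * r))" using s(1) e r by simp
      then have "f y $ i \<le> f x $ i" using s(4)[of i] by (simp add: y_def)
      also have "\<dots> \<le> tb $ i" using fx by (simp add: less_eq_vec_def)
      finally show ?thesis .
    qed
    then have "f y \<le> tb" by (simp add: less_eq_vec_def)
    ultimately have "y \<in> S" by (simp add: S_iff)
    then have "\<phi> x \<le> \<phi> y" by (rule x(2))
    moreover have "e / 4 * \<rho> y \<le> e / 4 * (\<rho> x + 2 * s / r)"
      using \<rho>y e by (intro mult_left_mono) auto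
    moreover have "e / 4 * (\<rho> x + 2 * s / r) = e / 4 * \<rho> x + s * (e / (2 * r))"
      by (simp add: distrib_left)
    moreover have "f y $ j < f x $ j - s * (e / (2 * r))" using s(4)[of j] by (simp add: y_def)
    ultimately show False unfolding \<phi>_def by linarith
  qed
  moreover have "norm x0 * exp (- q) \<le> norm x" using x(1) by (simp add: S_def R_def not_less)
  ultimately show ?thesis using that fx by (simp add: r_def)
qed

section \<open>Asymptotic values of an unbounded sublevel set\<close>

text \<open>Compactness of the box \<open>{a..tb}\<close> gives a subsequence with convergent
  values. The index map \<open>r\<close> is exported so that a \<open>P\<close> encoding a rate of
  convergence can still be used.\<close>

lemma escaping_sequence_with_limit:
  fixes f :: "'a::real_normed_vector \<Rightarrow> real ^ 'm"
  assumes box: "\<And>x. f x \<le> tb \<Longrightarrow> a \<le> f x"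
    and ex: "\<And>k :: nat. \<exists>x. f x \<le> tb \<and> real k \<le> norm x \<and> P k x"
  obtains x t r where "\<And>k. f (x k) \<le> tb" "filterlim (\<lambda>k. norm (x k)) at_top sequentially"
    "(\<lambda>k. f (x k)) \<longlonglongrightarrow> t" "strict_mono r" "\<And>k. P (r k) (x k)"
proof -
  obtain y where y: "\<And>k. f (y k) \<le> tb" "\<And>k. real k \<le> norm (y k)" "\<And>k. P k (y k)"
    using ex by metis
  have "compact {a..tb}" by (simp add: interval_cbox_cart)
  moreover have "\<forall>k. f (y k) \<in> {a..tb}" using y(1) box by simp
  ultimately obtain t r where r: "strict_mono r" "((\<lambda>k. f (y k)) \<circ> r) \<longlonglongrightarrow> t"
    unfolding compact_def by meson
  have "filterlim (\<lambda>k. norm (y (r k))) at_top sequentially"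
  proof (rule filterlim_at_top_mono[OF filterlim_real_sequentially], rule always_eventually, rule allI)
    fix k
    have "real k \<le> real (r k)" using seq_suble[OF r(1)] by simp
    then show "real k \<le> norm (y (r k))" using y(2)[of "r k"] by linarith
  qed
  then show ?thesis using that[of "\<lambda>k. y (r k)" t r] y r by (simp add: o_def)
qed

lemma unbounded_sublevel_point:
  assumes "\<not> bounded {x. f x \<le> tb}"
  obtains x where "f x \<le> tb" "B < norm x"
  using assms unfolding bounded_iff by (metis mem_Collect_eq not_le)

lemma T_inf_nonempty:
  fixes f :: "real ^ 'n \<Rightarrow> real ^ 'm"
  assumes diff: "\<And>x. f differentiable (at x)" and box: "\<And>x. f x \<le> tb \<Longrightarrow> a \<le> f x"
    and unb: "\<not> bounded {x. f x \<le> tb}"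
  shows "T_inf f tb \<noteq> {}"
proof -
  have ex: "\<exists>x. f x \<le> tb \<and> real k \<le> norm x \<and> x \<in> tangency_variety f" for k
  proof -
    obtain x0 where x0: "f x0 \<le> tb" "real k < norm x0"
      by (rule unbounded_sublevel_point[OF unb])
    then have "x0 \<noteq> 0" by auto
    then obtain x where "x \<in> tangency_variety f" "f x \<le> tb" "norm x = norm x0"
      using tangency_point_on_sphere[OF diff x0(1)] by blast
    then show ?thesis using x0(2) by (intro exI[of _ x]) simp
  qed
  obtain x t r where "\<And>k. f (x k) \<le> tb" "filterlim (\<lambda>k. norm (x k)) at_top sequentially"
    "(\<lambda>k. f (x k)) \<longlonglongrightarrow> t" "strict_mono (r :: nat \<Rightarrow> nat)" "\<And>k. x k \<in> tangency_variety f"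
    by (rule escaping_sequence_with_limit[of f tb a "\<lambda>_ x. x \<in> tangency_variety f", OF box ex])
      (assumption | rule that)+
  then have "t \<in> T_inf f tb" unfolding T_inf_def by blast
  then show ?thesis by blast
qed

lemma rabier_nonneg: "0 \<le> rabier f x"
  by (rule rabier_attained[of f x]) simp

lemma K_inf_nonempty:
  fixes f :: "real ^ 'n \<Rightarrow> real ^ 'm"
  assumes diff: "\<And>x. f differentiable (at x)" and box: "\<And>x. f x \<le> tb \<Longrightarrow> a \<le> f x"
    and unb: "\<not> bounded {x. f x \<le> tb}"
  shows "K_inf f tb \<noteq> {}"
proof -
  fix j :: 'm
  have ex: "\<exists>x. f x \<le> tb \<and> real k \<le> norm x \<and> norm x * rabier f x < inverse (real (Suc k))" for k
  proof -
    define e where "e = inverse (real (Suc k))"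
    have e: "e > 0" by (simp add: e_def)
    \<comment> \<open>The summand 1 makes the inequality \<open>4 * (tb $ j - a $ j) < e * q\<close>
      strict.\<close>
    define q where "q = 4 * (tb $ j - a $ j) / e + 1"
    \<comment> \<open>The factor \<open>exp q\<close> compensates for the possible loss
      \<open>exp (- q)\<close> of norm in passing from \<open>x0\<close> to the almost critical
      point.\<close>
    obtain x0 where x0: "f x0 \<le> tb" "real k * exp q < norm x0"
      by (rule unbounded_sublevel_point[OF unb])
    have "0 \<le> real k * exp q" by simp
    then have "0 < norm x0" using x0(2) by linarith
    then have nz: "x0 \<noteq> 0" by simp
    have q: "4 * (tb $ j - a $ j) < e * q" using e by (simp add: q_def distrib_left)
    have lower: "a $ j \<le> f x $ j" if "f x \<le> tb" for x
      using box[OF that] by (simp add: less_eq_vec_def)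
    obtain x where x: "f x \<le> tb" "norm x0 * exp (- q) \<le> norm x"
      "norm x * rabier f x < e"
      by (rule almost_critical_point[OF diff x0(1) nz lower e q])
    have "real k = real k * exp q * exp (- q)" by (simp add: exp_minus)
    also have "\<dots> \<le> norm x0 * exp (- q)" using x0(2) by (intro mult_right_mono) auto
    finally have "real k \<le> norm x" using x(2) by linarith
    then show ?thesis using x(1,3) unfolding e_def by blast
  qed
  obtain x t r where x: "\<And>k. f (x k) \<le> tb" "filterlim (\<lambda>k. norm (x k)) at_top sequentially"
    "(\<lambda>k. f (x k)) \<longlonglongrightarrow> t" "strict_mono r"
    "\<And>k. norm (x k) * rabier f (x k) < inverse (real (Suc (r k)))"
    by (rule escaping_sequence_with_limit
        [of f tb a "\<lambda>k x. norm x * rabier f x < inverse (real (Suc k))", OF box ex])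
      (assumption | rule that)+
  have "(\<lambda>k. norm (x k) * rabier f (x k)) \<longlonglongrightarrow> 0"
  proof (rule tendsto_sandwich[OF _ _ tendsto_const])
    show "\<forall>\<^sub>F k in sequentially. 0 \<le> norm (x k) * rabier f (x k)"
      by (simp add: rabier_nonneg)
    show "\<forall>\<^sub>F k in sequentially. norm (x k) * rabier f (x k) \<le> inverse (real (Suc (r k)))"
      using x(5) by (intro always_eventually allI less_imp_le)
    show "(\<lambda>k. inverse (real (Suc (r k)))) \<longlonglongrightarrow> 0"
      using LIMSEQ_subseq_LIMSEQ[OF LIMSEQ_inverse_real_of_nat x(4)] by (simp add: o_def)
  qed
  then have "t \<in> K_inf f tb" using x(1-3) unfolding K_inf_def by blast
  then show ?thesis by blast
qed

text \<open>Once the norms are at least 1, multiplying by them can only increase the nonnegative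
  \<open>rabier\<close> values.\<close>

lemma K_inf_subset_Ktilde_inf: "K_inf f tb \<subseteq> Ktilde_inf f tb"
proof
  fix t assume "t \<in> K_inf f tb"
  then obtain x where x: "\<forall>k. f (x k) \<le> tb" "filterlim (\<lambda>k. norm (x k)) at_top sequentially"
    "(\<lambda>k. f (x k)) \<longlonglongrightarrow> t" "(\<lambda>k. norm (x k) * rabier f (x k)) \<longlonglongrightarrow> 0"
    unfolding K_inf_def by blast
  have "\<forall>\<^sub>F k in sequentially. 1 \<le> norm (x k)"
    using x(2) by (simp add: filterlim_at_top)
  then have "\<forall>\<^sub>F k in sequentially. rabier f (x k) \<le> norm (x k) * rabier f (x k)"
    by eventually_elim (use mult_right_mono[OF _ rabier_nonneg] in force)
  then have "(\<lambda>k. rabier f (x k)) \<longlonglongrightarrow> 0"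
    by (intro tendsto_sandwich[OF _ _ tendsto_const x(4)]) (auto simp: rabier_nonneg)
  then show "t \<in> Ktilde_inf f tb" unfolding Ktilde_inf_def using x by blast
qed

lemma no_escaping_sequence:
  assumes "bounded {x. f x \<le> tb}" and "\<And>k :: nat. f (x k) \<le> tb"
  shows "\<not> filterlim (\<lambda>k. norm (x k)) at_top sequentially"
proof
  assume lim: "filterlim (\<lambda>k. norm (x k)) at_top sequentially"
  obtain B where B: "\<And>k. norm (x k) \<le> B" using assms unfolding bounded_iff by blast
  have "\<forall>\<^sub>F k in sequentially. B < norm (x k)" using lim by (simp add: filterlim_at_top_dense)
  then obtain k where "B < norm (x k)" using eventually_happens[of _ sequentially] by auto
  then show False using B[of k] by simp
qed

section \<open>Properness, Pareto solutions and the equivalences\<close>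

lemma section_at_eq: "section_at A t = A \<inter> {..t}"
proof -
  have "(\<lambda>s. t - s) ` nonneg_orthant = {..t}"
    by (force simp: nonneg_orthant_def image_iff intro: exI[of _ "t - _"])
  then show ?thesis by (simp add: section_at_def)
qed

text \<open>The sublevel set is itself the preimage of the compact box \<open>{a..tb}\<close>;
  conversely it contains every closed preimage that properness concerns.\<close>

lemma proper_iff_bounded_sublevel:
  fixes f :: "real ^ 'n \<Rightarrow> real ^ 'm"
  assumes cont: "continuous_on UNIV f" and box: "\<And>x. f x \<le> tb \<Longrightarrow> a \<le> f x"
  shows "proper_at_sublevel f tb \<longleftrightarrow> bounded {x. f x \<le> tb}"
proof
  assume "proper_at_sublevel f tb"
  moreover have "compact {a..tb}" by (simp add: interval_cbox_cart)
  moreover have "{a..tb} \<subseteq> section_at UNIV tb" by (auto simp: section_at_eq)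
  ultimately have "compact (f -` {a..tb})" unfolding proper_at_sublevel_def by blast
  moreover have "f -` {a..tb} = {x. f x \<le> tb}" using box by auto
  ultimately show "bounded {x. f x \<le> tb}" by (simp add: compact_imp_bounded)
next
  assume bdd: "bounded {x. f x \<le> tb}"
  show "proper_at_sublevel f tb"
    unfolding proper_at_sublevel_def
  proof (intro allI impI)
    fix A assume A: "compact A \<and> A \<subseteq> section_at UNIV tb"
    then have "closed (f -` A)"
      using cont by (auto intro!: closed_vimage simp: compact_imp_closed continuous_on_eq_continuous_within)
    moreover have "f -` A \<subseteq> {x. f x \<le> tb}" using A by (auto simp: section_at_eq)
    ultimately show "compact (f -` A)" using bdd
      by (auto simp: compact_eq_bounded_closed intro: bounded_subset)
  qed
qed

text \<open>Scalarisation: minimise the sum of the components over the compact sublevel set. A point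
  dominating the minimiser would again lie in that set and have a strictly smaller sum.\<close>

lemma pareto_solution_exists:
  fixes f :: "real ^ 'n \<Rightarrow> real ^ 'm"
  assumes cont: "continuous_on UNIV f" and bdd: "bounded {x. f x \<le> tb}" and "tb \<in> range f"
  shows "\<exists>x. pareto_solution f x"
proof -
  have "compact {x. f x \<le> tb}"
    using bdd closed_sublevel[OF cont] by (simp add: compact_eq_bounded_closed)
  moreover have "{x. f x \<le> tb} \<noteq> {}" using assms(3) by auto
  moreover have "continuous_on {x. f x \<le> tb} (\<lambda>x. \<Sum>i\<in>UNIV. f x $ i)"
    by (intro continuous_intros continuous_on_subset[OF cont]) simp
  ultimately obtain x where x: "f x \<le> tb"
    "\<And>y. f y \<le> tb \<Longrightarrow> (\<Sum>i\<in>UNIV. f x $ i) \<le> (\<Sum>i\<in>UNIV. f y $ i)"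
    using continuous_attains_inf[of "{x. f x \<le> tb}" "\<lambda>x. \<Sum>i\<in>UNIV. f x $ i"] by blast
  have "f y \<notin> (\<lambda>s. f x - s) ` (nonneg_orthant - {0})" for y
  proof
    assume "f y \<in> (\<lambda>s. f x - s) ` (nonneg_orthant - {0})"
    then obtain s where s: "\<And>i. 0 \<le> s $ i" "s \<noteq> 0" "f y = f x - s"
      by (auto simp: nonneg_orthant_def less_eq_vec_def)
    have "f y \<le> f x" using s by (simp add: less_eq_vec_def)
    then have "(\<Sum>i\<in>UNIV. f x $ i) \<le> (\<Sum>i\<in>UNIV. f y $ i)" using x by (meson order_trans)
    then have "(\<Sum>i\<in>UNIV. s $ i) \<le> 0" by (simp add: s(3) sum_subtractf)
    moreover have "0 \<le> (\<Sum>i\<in>UNIV. s $ i)" by (simp add: s(1) sum_nonneg)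
    ultimately have "(\<Sum>i\<in>UNIV. s $ i) = 0" by simp
    then have "\<forall>i. s $ i = 0" using s(1) by (simp add: sum_nonneg_eq_0_iff)
    then show False using s(2) by (simp add: vec_eq_iff)
  qed
  then show ?thesis unfolding pareto_solution_def by blast
qed

theorem theorem4p1:
  fixes f :: "real ^ 'n \<Rightarrow> real ^ 'm" and tb :: "real ^ 'm"
  assumes "polynomial_function f"
    and "tb \<in> range f"
    and "orthant_bounded (section_at (range f) tb)"
  shows "(proper_at_sublevel f tb \<longleftrightarrow> palais_smale_at f tb) \<and>
         (palais_smale_at f tb \<longleftrightarrow> weak_palais_smale_at f tb) \<and>
         (weak_palais_smale_at f tb \<longleftrightarrow> M_tame_at f tb) \<and>
         (proper_at_sublevel f tb \<or> palais_smale_at f tb \<or>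
          weak_palais_smale_at f tb \<or> M_tame_at f tb \<longrightarrow>
            (\<exists>x. pareto_solution f x))"
proof -
  have diff: "f differentiable (at x)" for x
    using assms(1) by (rule differentiable_at_polynomial_function)
  have cont: "continuous_on UNIV f"
    by (rule continuous_on_polymonial_function[OF assms(1)])
  obtain a where "section_at (range f) tb \<subseteq> (\<lambda>s. a + s) ` nonneg_orthant"
    using assms(3) unfolding orthant_bounded_def by blast
  then have box: "a \<le> f x" if "f x \<le> tb" for x
    using that by (force simp: section_at_eq nonneg_orthant_def)
  \<comment> \<open>\<open>?B\<close> is the hub: it is equivalent to properness and to M-tameness,
    and closes a cycle through the Palais-Smale and weak Palais-Smale conditions.\<close>
  let ?B = "bounded {x. f x \<le> tb}"
  have "palais_smale_at f tb" "M_tame_at f tb" if ?B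
    using no_escaping_sequence[OF that]
    unfolding palais_smale_at_def Ktilde_inf_def M_tame_at_def T_inf_def by auto
  moreover have "weak_palais_smale_at f tb" if "palais_smale_at f tb"
    using that K_inf_subset_Ktilde_inf[of f tb]
    unfolding palais_smale_at_def weak_palais_smale_at_def by blast
  moreover have "?B" if "weak_palais_smale_at f tb"
    using that K_inf_nonempty[OF diff box] unfolding weak_palais_smale_at_def by blast
  moreover have "?B" if "M_tame_at f tb"
    using that T_inf_nonempty[OF diff box] unfolding M_tame_at_def by blast
  moreover have "\<exists>x. pareto_solution f x" if ?B
    by (rule pareto_solution_exists[OF cont that assms(2)])
  ultimately show ?thesis using proper_iff_bounded_sublevel[OF cont box] by blast
qed

end
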